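(* For real $\nu>-1$ and $x>0$ let $I_\nu$ denote the modified Bessel function of the first kind, and set $$\Phi_{\nu}(x)=e^{-x}x^{-\nu}\left[I_{\nu}(x)+I_{\nu+1}(x)\right],\qquad \Psi_\nu(x)=\sqrt{\pi}\,2^{\nu}\,\Gamma\!\left(\nu+\tfrac12\right)\Phi_\nu(x)\ \ (\nu>-\tfrac12).$$ Then for each fixed $x>0$: the function $\nu\mapsto\Phi_\nu(x)$ is log-concave on $(-1,\infty)$, and the function $\nu\mapsto\Psi_\nu(x)$ is completely monotonic and log-convex on $\left(-\tfrac12,\infty\right)$. Moreover, for all $\nu>\tfrac12$ and $x>0$ the Turán type inequality $$0<\left[\Phi_{\nu}(x)\right]^2-\Phi_{\nu-1}(x)\Phi_{\nu+1}(x)\le\frac{1}{\nu+\frac{1}{2}}\left[\Phi_{\nu}(x)\right]^2$$ holds, and the left-hand inequality $\left[\Phi_{\nu}(x)\right]^2-\Phi_{\nu-1}(x)\Phi_{\nu+1}(x)>0$ holds for all $\nu>-1$ and $x>0$.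
   Context: A function $f$ on an interval $J$ is completely monotonic if it has derivatives of all orders and $(-1)^m f^{(m)}\ge 0$ on $J$ for all $m\in\{0,1,2,\dots\}$. A positive function is log-convex (log-concave) if its natural logarithm is convex (concave). *)

theory Defs
  imports "HOL-Analysis.Analysis"
begin

text \<open>Modified Bessel function of the first kind of real order nu, for x > 0:
  I_nu(x) = sum_k (x/2)^(2k+nu) / (k! Gamma(k+nu+1)), with 1/Gamma taken as rGamma
  (which vanishes at the poles of Gamma, the standard convention).\<close>
definition besselI :: "real \<Rightarrow> real \<Rightarrow> real" where
  "besselI nu x = (\<Sum>k. rGamma (real k + nu + 1) / fact k * (x / 2) powr (2 * real k + nu))"

definition Phi :: "real \<Rightarrow> real \<Rightarrow> real" where
  "Phi nu x = exp (- x) * x powr (- nu) * (besselI nu x + besselI (nu + 1) x)"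

definition Psi :: "real \<Rightarrow> real \<Rightarrow> real" where
  "Psi nu x = sqrt pi * 2 powr nu * Gamma (nu + 1 / 2) * Phi nu x"

definition completely_monotonic_on :: "real set \<Rightarrow> (real \<Rightarrow> real) \<Rightarrow> bool" where
  "completely_monotonic_on J f \<longleftrightarrow>
     (\<forall>m. \<forall>t\<in>J. ((deriv ^^ m) f) differentiable (at t)) \<and>
     (\<forall>m. \<forall>t\<in>J. (-1) ^ m * (deriv ^^ m) f t \<ge> 0)"

definition log_convex_on :: "real set \<Rightarrow> (real \<Rightarrow> real) \<Rightarrow> bool" where
  "log_convex_on J f \<longleftrightarrow> (\<forall>t\<in>J. f t > 0) \<and> convex_on J (\<lambda>t. ln (f t))"

definition log_concave_on :: "real set \<Rightarrow> (real \<Rightarrow> real) \<Rightarrow> bool" where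
  "log_concave_on J f \<longleftrightarrow> (\<forall>t\<in>J. f t > 0) \<and> concave_on J (\<lambda>t. ln (f t))"

end

(* With y = x/2 and C_nu(z) = sum_k z^k / (k! Gamma(nu+k+1)) one has
   Phi_nu(x) = exp(-x) 2^(-nu) (C_nu(y^2) + y C_(nu+1)(y^2)).

   By the Cauchy product and Vandermonde's identity,
     C_mu(z) C_nu(z) = sum_k (mu+nu+k+1)_k / k! * z^k / (Gamma(mu+k+1) Gamma(nu+k+1)),
   so when mu + nu = 2m is fixed only the Gamma factors vary, and a comparison
   1/(Gamma(mu+k+1) Gamma(nu+k+1)) <= 1/Gamma(m+k+1)^2 for all k carries over to Phi.
   Log-convexity of Gamma yields midpoint log-concavity of Phi (whence log-concavity, by
   continuity), and mu = m - 1, nu = m + 1 yields the strict Turan inequality.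

   Sonine's integral for C_nu gives Psi_nu(x) = int_0^1 w(u) (1-u)^nu du with w >= 0: a Laplace
   transform in nu of a positive measure under theta = -ln(1-u). Hence complete monotonicity,
   and log-convexity by Cauchy-Schwarz. The upper Turan bound is log-convexity of Psi at
   nu - 1, nu, nu + 1 together with Gamma(s+1) = s Gamma(s). *)
theory Submission
  imports Defs
begin

subsection \<open>The Bessel--Clifford series\<close>

text \<open>Compactness bounds \<open>rGamma\<close> on an interval containing {1..2}. Beyond it the
  recurrence rGamma y = y * rGamma (y + 1) shows that unit steps from y >= 1 never increase the
  absolute value.\<close>

lemma rGamma_real_bounded:
  obtains C where "\<And>x::real. c \<le> x \<Longrightarrow> \<bar>rGamma x\<bar> \<le> C"
proof -
  define K where "K = {min c 1..2::real}"
  have "compact (rGamma ` K)"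
    unfolding K_def by (intro compact_continuous_image continuous_on_rGamma) auto
  then obtain C where C: "\<And>x. x \<in> K \<Longrightarrow> \<bar>rGamma x\<bar> \<le> C"
    using compact_imp_bounded[of "rGamma ` K"] by (auto simp: bounded_iff)
  have step: "\<bar>rGamma (x + real n)\<bar> \<le> C" if "x \<in> {1..2}" for x n
  proof (induction n)
    case 0
    then show ?case using C[of x] that by (auto simp: K_def)
  next
    case (Suc n)
    have y: "x + real n \<ge> 1" using that by auto
    have "\<bar>rGamma (x + real n + 1)\<bar> \<le> (x + real n) * \<bar>rGamma (x + real n + 1)\<bar>"
      using y by (simp add: mult_le_cancel_right1)
    also have "\<dots> = \<bar>rGamma (x + real n)\<bar>"
      using y rGamma_plus1[of "x + real n"] by (metis abs_mult abs_of_nonneg order_trans zero_le_one)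
    finally show ?case using Suc by (simp add: add_ac)
  qed
  have "\<bar>rGamma x\<bar> \<le> C" if "c \<le> x" for x
  proof (cases "x \<le> 2")
    case True
    then show ?thesis using C[of x] that by (auto simp: K_def)
  next
    case False
    \<comment> \<open>Chosen so that \<open>x - real n\<close> lies in [1, 2), the base of the unit
      steps.\<close>
    define n where "n = nat (\<lfloor>x\<rfloor> - 1)"
    have "real n = of_int \<lfloor>x\<rfloor> - 1" using False by (simp add: n_def le_floor_iff)
    then have "x - real n \<in> {1..2}" by (simp; linarith)
    then show ?thesis using step[of "x - real n" n] by simp
  qed
  then show ?thesis using that by blast
qed

text \<open>The Bessel--Clifford function: a pure power series, free of the factor (x/2) powr \<nu>.
  With \<open>rGamma\<close> it makes sense at every real order, including the orders \<nu> - 1 <=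
  -1 of the Turan inequality.\<close>

definition bessel_clifford :: "real \<Rightarrow> real \<Rightarrow> real" where
  "bessel_clifford \<nu> z = (\<Sum>k. rGamma (real k + \<nu> + 1) / fact k * z ^ k)"

text \<open>The majorant depends on \<open>c\<close> only, so it is uniform over all orders \<nu> >=
  c and serves the Weierstrass test in the order as well as summability.\<close>

lemma bessel_clifford_term_bound:
  assumes "\<And>x. c + 1 \<le> x \<Longrightarrow> \<bar>rGamma x\<bar> \<le> C" "c \<le> \<nu>"
  shows "norm (rGamma (real k + \<nu> + 1) / fact k * z ^ k) \<le> C * (\<bar>z\<bar> ^ k / fact k)"
proof -
  have "\<bar>rGamma (real k + \<nu> + 1)\<bar> \<le> C" using assms by auto
  then have "\<bar>rGamma (real k + \<nu> + 1)\<bar> * (\<bar>z\<bar> ^ k / fact k) \<le> C * (\<bar>z\<bar> ^ k / fact k)"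
    by (rule mult_right_mono) simp
  then show ?thesis by (simp add: abs_mult power_abs)
qed

lemma summable_power_div_fact: "summable (\<lambda>k. C * (x ^ k / fact k :: real))"
  using summable_exp[of x] by (intro summable_mult) (simp add: field_simps)

lemma bessel_clifford_summable_norm:
  "summable (\<lambda>k. norm (rGamma (real k + \<nu> + 1) / fact k * z ^ k))"
proof -
  obtain C where C: "\<And>x::real. \<nu> + 1 \<le> x \<Longrightarrow> \<bar>rGamma x\<bar> \<le> C"
    using rGamma_real_bounded by metis
  show ?thesis
    by (rule summable_comparison_test'[OF summable_power_div_fact[of C "\<bar>z\<bar>"], of 0])
      (use bessel_clifford_term_bound[OF C] in simp)
qed

lemma bessel_clifford_sums:
  "(\<lambda>k. rGamma (real k + \<nu> + 1) / fact k * z ^ k) sums bessel_clifford \<nu> z"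
  unfolding bessel_clifford_def
  by (rule summable_sums, rule summable_norm_cancel, rule bessel_clifford_summable_norm)

lemma continuous_on_bessel_clifford: "continuous_on A (\<lambda>\<nu>. bessel_clifford \<nu> z)"
proof -
  have *: "continuous_on {c..} (\<lambda>\<nu>. bessel_clifford \<nu> z)" for c
  proof -
    obtain C where C: "\<And>x::real. c + 1 \<le> x \<Longrightarrow> \<bar>rGamma x\<bar> \<le> C"
      using rGamma_real_bounded by metis
    have "uniform_limit {c..} (\<lambda>n \<nu>. \<Sum>k<n. rGamma (real k + \<nu> + 1) / fact k * z ^ k)
        (\<lambda>\<nu>. bessel_clifford \<nu> z) sequentially"
      unfolding bessel_clifford_def
      by (rule Weierstrass_m_test[OF _ summable_power_div_fact[of C "\<bar>z\<bar>"]])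
        (use bessel_clifford_term_bound[OF C] in simp)
    moreover have "continuous_on {c..} (\<lambda>\<nu>. \<Sum>k<n. rGamma (real k + \<nu> + 1) / fact k * z ^ k)" for n
      by (intro continuous_intros continuous_on_compose2[OF continuous_on_rGamma[of UNIV]]) auto
    ultimately show ?thesis
      by (intro uniform_limit_theorem[where F = sequentially]) auto
  qed
  have "isCont (\<lambda>\<nu>. bessel_clifford \<nu> z) \<nu>" for \<nu>
    \<comment> \<open>Starting the half-line at \<nu> - 1 makes \<nu> an interior point.\<close>
    using continuous_on_interior[OF *[of "\<nu> - 1"], of \<nu>] by simp
  then show ?thesis by (simp add: continuous_at_imp_continuous_on)
qed

text \<open>In the Cauchy product each \<open>rGamma\<close> is a generalized binomial coefficient
  times an \<open>rGamma\<close> at index k. The latter no longer involves the summation index, so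
  Vandermonde's identity evaluates the inner sum.\<close>

lemma bessel_clifford_product_sums:
  "(\<lambda>k. pochhammer (\<mu> + \<nu> + real k + 1) k / fact k
      * (rGamma (real k + \<mu> + 1) * rGamma (real k + \<nu> + 1)) * z ^ k)
    sums (bessel_clifford \<mu> z * bessel_clifford \<nu> z)"
proof -
  let ?t = "\<lambda>\<nu> k. rGamma (real k + \<nu> + 1) / fact k * z ^ k"
  have coeff: "(\<Sum>i\<le>k. ?t \<mu> i * ?t \<nu> (k - i)) = pochhammer (\<mu> + \<nu> + real k + 1) k / fact k
      * (rGamma (real k + \<mu> + 1) * rGamma (real k + \<nu> + 1)) * z ^ k" for k
  proof -
    have r: "rGamma (real i + \<nu> + 1) / fact j = ((\<nu> + real k) gchoose j) * rGamma (real k + \<nu> + 1)"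
      if "i + j = k" for i j and \<nu> :: real
    proof -
      have "rGamma (real i + \<nu> + 1)
          = pochhammer (real i + \<nu> + 1) j * rGamma (real i + \<nu> + 1 + real j)"
        by (rule pochhammer_rGamma)
      also have "real i + \<nu> + 1 + real j = real k + \<nu> + 1" using that by auto
      finally have "rGamma (real i + \<nu> + 1) / fact j
          = pochhammer (real i + \<nu> + 1) j / fact j * rGamma (real k + \<nu> + 1)" by simp
      moreover have e: "\<nu> + real k - real j + 1 = real i + \<nu> + 1" using that by auto
      ultimately show ?thesis unfolding gbinomial_pochhammer' e by (simp only:)
    qed
    have "(\<Sum>i\<le>k. ?t \<mu> i * ?t \<nu> (k - i))
        = (\<Sum>i\<le>k. (((\<nu> + real k) gchoose i) * ((\<mu> + real k) gchoose (k - i)))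
            * (rGamma (real k + \<mu> + 1) * rGamma (real k + \<nu> + 1) * z ^ k))"
    proof (rule sum.cong[OF refl])
      fix i assume "i \<in> {..k}"
      then have i: "i + (k - i) = k" "(k - i) + i = k" by auto
      \<comment> \<open>The factorials are exchanged between the two factors: \<open>r\<close> needs
        the index of \<open>rGamma\<close> and the argument of \<open>fact\<close> to add up to
        k.\<close>
      have "?t \<mu> i * ?t \<nu> (k - i)
        = (rGamma (real i + \<mu> + 1) / fact (k - i)) * (rGamma (real (k - i) + \<nu> + 1) / fact i)
            * (z ^ i * z ^ (k - i))"
        by (simp only: divide_inverse mult_ac)
      also have "z ^ i * z ^ (k - i) = z ^ k" using i by (simp flip: power_add)
      finally show "?t \<mu> i * ?t \<nu> (k - i)
        = (((\<nu> + real k) gchoose i) * ((\<mu> + real k) gchoose (k - i)))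
            * (rGamma (real k + \<mu> + 1) * rGamma (real k + \<nu> + 1) * z ^ k)"
        unfolding r[OF i(1)] r[OF i(2)] by (simp add: mult_ac)
    qed
    also have "\<dots> = ((\<nu> + real k + (\<mu> + real k)) gchoose k)
            * (rGamma (real k + \<mu> + 1) * rGamma (real k + \<nu> + 1) * z ^ k)"
      unfolding sum_distrib_right[symmetric] gbinomial_Vandermonde[symmetric] atMost_atLeast0 ..
    also have "(\<nu> + real k + (\<mu> + real k)) gchoose k = pochhammer (\<mu> + \<nu> + real k + 1) k / fact k"
      by (simp add: gbinomial_pochhammer' algebra_simps)
    finally show ?thesis by (simp add: mult_ac)
  qed
  show ?thesis
    using Cauchy_product_sums[OF bessel_clifford_summable_norm[of \<mu> z] bessel_clifford_summable_norm[of \<nu> z]]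
    unfolding coeff bessel_clifford_def .
qed

lemma bessel_clifford_pos:
  assumes "\<nu> > -1" "z \<ge> 0"
  shows "bessel_clifford \<nu> z > 0"
proof -
  have "0 < (\<Sum>k. rGamma (real k + \<nu> + 1) / fact k * z ^ k)"
  proof (rule suminf_pos2)
    show "summable (\<lambda>k. rGamma (real k + \<nu> + 1) / fact k * z ^ k)"
      using bessel_clifford_sums by (rule sums_summable)
    show "0 \<le> rGamma (real k + \<nu> + 1) / fact k * z ^ k" for k
      using assms Gamma_real_pos[of "real k + \<nu> + 1"]
      by (auto simp: rGamma_inverse_Gamma intro!: mult_nonneg_nonneg)
    show "0 < rGamma (real 0 + \<nu> + 1) / fact 0 * z ^ 0"
      using assms Gamma_real_pos[of "\<nu> + 1"] by (auto simp: rGamma_inverse_Gamma)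
  qed
  then show ?thesis by (simp add: bessel_clifford_def)
qed

text \<open>This is \<open>Phi\<close> at x = 2 y without the factor exp (-x) * 2 powr (-\<nu>). The
  logarithm of that factor is affine in \<nu>, so log-concavity and symmetric comparisons of orders
  are unaffected by it.\<close>

definition bessel_sum :: "real \<Rightarrow> real \<Rightarrow> real" where
  "bessel_sum y \<nu> = bessel_clifford \<nu> (y\<^sup>2) + y * bessel_clifford (\<nu> + 1) (y\<^sup>2)"

lemma besselI_eq_bessel_clifford:
  assumes "x > 0"
  shows "besselI \<nu> x = (x / 2) powr \<nu> * bessel_clifford \<nu> ((x / 2)\<^sup>2)"
proof -
  have "rGamma (real k + \<nu> + 1) / fact k * (x / 2) powr (2 * real k + \<nu>)
      = (x / 2) powr \<nu> * (rGamma (real k + \<nu> + 1) / fact k * ((x / 2)\<^sup>2) ^ k)" for k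
    using assms powr_realpow[of "x / 2" "2 * k"] by (simp add: powr_add power_mult)
  moreover have "(\<lambda>k. (x / 2) powr \<nu> * (rGamma (real k + \<nu> + 1) / fact k * ((x / 2)\<^sup>2) ^ k))
      sums ((x / 2) powr \<nu> * bessel_clifford \<nu> ((x / 2)\<^sup>2))"
    by (intro sums_mult bessel_clifford_sums)
  ultimately show ?thesis
    unfolding besselI_def by (simp only: sums_iff)
qed

lemma Phi_eq_bessel_sum:
  assumes "x > 0"
  shows "Phi \<nu> x = exp (- x) * 2 powr (- \<nu>) * bessel_sum (x / 2) \<nu>"
proof -
  have "x powr (- \<nu>) * (x / 2) powr \<nu> = 2 powr (- \<nu>)"
    using assms by (simp add: powr_divide powr_minus field_simps)
  moreover have "(x / 2) powr (\<nu> + 1) = (x / 2) powr \<nu> * (x / 2)"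
    using assms by (simp add: powr_add)
  moreover have "Phi \<nu> x = exp (- x) * (x powr (- \<nu>) * (x / 2) powr \<nu>) * bessel_sum (x / 2) \<nu>"
    unfolding Phi_def besselI_eq_bessel_clifford[OF assms] bessel_sum_def calculation(2)
    by (simp add: algebra_simps)
  ultimately show ?thesis by simp
qed

lemma bessel_sum_pos:
  assumes "\<nu> > -1" "y > 0"
  shows "bessel_sum y \<nu> > 0"
  unfolding bessel_sum_def using assms by (intro add_pos_pos mult_pos_pos bessel_clifford_pos) auto

subsection \<open>Turan inequalities and log-concavity\<close>

text \<open>For k = 0 the base 2 m + 1 may be negative, but the product is empty; for k >= 1 the
  base is positive because m > -1.\<close>

lemma pochhammer_pos_shift:
  fixes m :: real
  assumes "m > -1"
  shows "pochhammer (2 * m + real k + 1) k > 0"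
proof (cases k)
  case (Suc n)
  then show ?thesis using assms by (intro pochhammer_pos) auto
qed auto

context
  fixes m \<mu> \<nu> z :: real
  assumes sum_eq: "\<mu> + \<nu> = 2 * m" and m: "m > -1" and z: "z > 0"
begin

text \<open>The \<open>rGamma\<close> comparison stays a hypothesis because it has two sources:
  log-convexity of \<open>Gamma\<close> for midpoints, and the recurrence for the orders m - 1, m +
  1.\<close>

lemma bessel_clifford_turan_le:
  assumes "\<And>k. rGamma (real k + \<mu> + 1) * rGamma (real k + \<nu> + 1) \<le> (rGamma (real k + m + 1))\<^sup>2"
  shows "bessel_clifford \<mu> z * bessel_clifford \<nu> z \<le> (bessel_clifford m z)\<^sup>2"
  unfolding power2_eq_square[of "bessel_clifford m z"]
proof (rule sums_le[OF _ bessel_clifford_product_sums bessel_clifford_product_sums])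
  fix k
  show "pochhammer (\<mu> + \<nu> + real k + 1) k / fact k
      * (rGamma (real k + \<mu> + 1) * rGamma (real k + \<nu> + 1)) * z ^ k
    \<le> pochhammer (m + m + real k + 1) k / fact k
      * (rGamma (real k + m + 1) * rGamma (real k + m + 1)) * z ^ k"
    using assms[of k] pochhammer_pos_shift[OF m, of k] z sum_eq
    by (intro mult_right_mono mult_left_mono) (auto simp: power2_eq_square intro!: divide_right_mono mult_left_mono)
qed

lemma bessel_clifford_turan_less:
  assumes "\<And>k. rGamma (real k + \<mu> + 1) * rGamma (real k + \<nu> + 1) < (rGamma (real k + m + 1))\<^sup>2"
  shows "bessel_clifford \<mu> z * bessel_clifford \<nu> z < (bessel_clifford m z)\<^sup>2"
proof -
  let ?t = "\<lambda>\<mu> \<nu> k. pochhammer (\<mu> + \<nu> + real k + 1) k / fact k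
      * (rGamma (real k + \<mu> + 1) * rGamma (real k + \<nu> + 1)) * z ^ k"
  have lt: "?t \<mu> \<nu> k < ?t m m k" for k
    using assms[of k] pochhammer_pos_shift[OF m, of k] z sum_eq
    by (intro mult_strict_right_mono)
      (auto simp: power2_eq_square intro!: mult_strict_left_mono divide_strict_right_mono)
  have "(\<lambda>k. ?t m m k - ?t \<mu> \<nu> k) sums ((bessel_clifford m z)\<^sup>2 - bessel_clifford \<mu> z * bessel_clifford \<nu> z)"
    unfolding power2_eq_square[of "bessel_clifford m z"]
    by (intro sums_diff bessel_clifford_product_sums)
  moreover from this have "0 < (\<Sum>k. ?t m m k - ?t \<mu> \<nu> k)"
    using lt by (intro suminf_pos) (auto simp: sums_iff)
  ultimately show ?thesis by (simp add: sums_iff)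
qed

text \<open>Over the common factor rGamma (k + \<mu> + 2) * rGamma (k + \<nu> + 2), the two cross
  products carry the weights k + \<nu> + 1 and k + \<mu> + 1. Their sum depends only on \<mu> +
  \<nu>, so a termwise comparison works for the sum of the products.\<close>

lemma bessel_clifford_turan_mixed:
  assumes "\<And>k. rGamma (real k + \<mu> + 1) * rGamma (real k + \<nu> + 1) \<le> (rGamma (real k + m + 1))\<^sup>2"
  shows "bessel_clifford (\<mu> + 1) z * bessel_clifford \<nu> z + bessel_clifford \<mu> z * bessel_clifford (\<nu> + 1) z
    \<le> 2 * (bessel_clifford m z * bessel_clifford (m + 1) z)"
proof -
  define s where "s \<mu> \<nu> k = pochhammer (\<mu> + \<nu> + 1 + real k + 1) k / fact k * (\<mu> + \<nu> + 2 * real k + 2)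
      * (rGamma (real k + \<mu> + 2) * rGamma (real k + \<nu> + 2)) * z ^ k" for \<mu> \<nu> k
  have s: "s \<mu> \<nu> sums (bessel_clifford (\<mu> + 1) z * bessel_clifford \<nu> z
        + bessel_clifford \<mu> z * bessel_clifford (\<nu> + 1) z)" for \<mu> \<nu>
  proof -
    have r: "rGamma (real k + \<nu> + 1) = (real k + \<nu> + 1) * rGamma (real k + \<nu> + 2)" for k \<nu>
      using rGamma_plus1[of "real k + \<nu> + 1"] by (simp add: add.assoc)
    have e: "\<mu> + 1 + \<nu> + real k + 1 = \<mu> + \<nu> + 1 + real k + 1"
      "\<mu> + (\<nu> + 1) + real k + 1 = \<mu> + \<nu> + 1 + real k + 1"
      "real k + (\<mu> + 1) + 1 = real k + \<mu> + 2" "real k + (\<nu> + 1) + 1 = real k + \<nu> + 2" for k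
      by simp_all
    have c: "P * (A * ((real k + \<nu> + 1) * B)) * Z + P * ((real k + \<mu> + 1) * A * B) * Z
        = P * (\<mu> + \<nu> + 2 * real k + 2) * (A * B) * Z" for P A B Z :: real and k
      by (simp add: algebra_simps)
    show ?thesis
      using sums_add[OF bessel_clifford_product_sums[of "\<mu> + 1" \<nu> z]
          bessel_clifford_product_sums[of \<mu> "\<nu> + 1" z]]
      unfolding e r[of _ \<mu>] r[of _ \<nu>] c s_def .
  qed
  have "s \<mu> \<nu> k \<le> s m m k" for k
  proof -
    have *: "0 < pochhammer (2 * m + 1 + real k + 1) k" using m by (intro pochhammer_pos) auto
    \<comment> \<open>The shift by one is absorbed by taking the hypothesis at index k + 1.\<close>
    have "rGamma (real k + \<mu> + 2) * rGamma (real k + \<nu> + 2) \<le> rGamma (real k + m + 2) * rGamma (real k + m + 2)"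
      using assms[of "Suc k"] by (simp add: power2_eq_square add_ac)
    then show ?thesis
      unfolding s_def sum_eq mult_2[symmetric] using * m z
      by (intro mult_right_mono mult_left_mono) auto
  qed
  from sums_le[OF this s[of \<mu> \<nu>] s[of m m]] show ?thesis by (simp add: mult_ac)
qed

end

section \<open>Transfer of the comparisons to \<open>bessel_sum\<close>\<close>

context
  fixes m \<mu> \<nu> y :: real
  assumes sum_eq: "\<mu> + \<nu> = 2 * m" and m: "m > -1" and y: "y > 0"
begin

lemma bessel_sum_turan_diff:
  assumes "\<And>k. rGamma (real k + \<mu> + 1) * rGamma (real k + \<nu> + 1) \<le> (rGamma (real k + m + 1))\<^sup>2"
  shows "(bessel_clifford m (y\<^sup>2))\<^sup>2 - bessel_clifford \<mu> (y\<^sup>2) * bessel_clifford \<nu> (y\<^sup>2)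
    \<le> (bessel_sum y m)\<^sup>2 - bessel_sum y \<mu> * bessel_sum y \<nu>"
proof -
  let ?C = "\<lambda>\<nu>. bessel_clifford \<nu> (y\<^sup>2)"
  have z: "y\<^sup>2 > 0" using y by simp
  have "y * (?C (\<mu> + 1) * ?C \<nu> + ?C \<mu> * ?C (\<nu> + 1)) \<le> y * (2 * (?C m * ?C (m + 1)))"
    using bessel_clifford_turan_mixed[OF sum_eq m z assms] y by simp
  moreover have "y\<^sup>2 * (?C (\<mu> + 1) * ?C (\<nu> + 1)) \<le> y\<^sup>2 * (?C (m + 1))\<^sup>2"
  proof (rule mult_left_mono[OF bessel_clifford_turan_le])
    show "rGamma (real k + (\<mu> + 1) + 1) * rGamma (real k + (\<nu> + 1) + 1)
      \<le> (rGamma (real k + (m + 1) + 1))\<^sup>2" for k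
      using assms[of "Suc k"] by (simp add: add_ac)
  qed (use sum_eq m z in auto)
  ultimately show ?thesis
    unfolding bessel_sum_def by (simp add: power2_eq_square algebra_simps)
qed

lemma bessel_sum_turan_le:
  assumes "\<And>k. rGamma (real k + \<mu> + 1) * rGamma (real k + \<nu> + 1) \<le> (rGamma (real k + m + 1))\<^sup>2"
  shows "bessel_sum y \<mu> * bessel_sum y \<nu> \<le> (bessel_sum y m)\<^sup>2"
  using bessel_sum_turan_diff[OF assms] bessel_clifford_turan_le[OF sum_eq m _ assms, of "y\<^sup>2"] y by simp

lemma bessel_sum_turan_less:
  assumes "\<And>k. rGamma (real k + \<mu> + 1) * rGamma (real k + \<nu> + 1) < (rGamma (real k + m + 1))\<^sup>2"
  shows "bessel_sum y \<mu> * bessel_sum y \<nu> < (bessel_sum y m)\<^sup>2"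
  using bessel_sum_turan_diff[OF less_imp_le[OF assms]]
    bessel_clifford_turan_less[OF sum_eq m _ assms, of "y\<^sup>2"] y by simp

end

text \<open>With t = k + \<nu> + 1 > 0 the recurrence gives (rGamma t)^2 - rGamma (t - 1) * rGamma
  (t + 1) = rGamma t * rGamma (t + 1) > 0. This covers t - 1 <= 0, where log-convexity of
  \<open>Gamma\<close> on the positive axis does not reach.\<close>

lemma Phi_turan_pos:
  assumes "\<nu> > -1" "x > 0"
  shows "Phi (\<nu> - 1) x * Phi (\<nu> + 1) x < (Phi \<nu> x)\<^sup>2"
proof -
  have "rGamma (real k + (\<nu> - 1) + 1) * rGamma (real k + (\<nu> + 1) + 1) < (rGamma (real k + \<nu> + 1))\<^sup>2" for k
  proof -
    define t where "t = real k + \<nu> + 1"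
    have t: "t > 0" using assms by (simp add: t_def)
    have a: "rGamma (t - 1) = (t - 1) * rGamma t" using rGamma_plus1[of "t - 1"] by simp
    have b: "rGamma t = t * rGamma (t + 1)" using rGamma_plus1[of t] by simp
    have "rGamma t > 0" "rGamma (t + 1) > 0" using t by (simp_all add: rGamma_inverse_Gamma)
    then have "0 < rGamma t * rGamma (t + 1)" by simp
    then have "rGamma (t - 1) * rGamma (t + 1) < (rGamma t)\<^sup>2"
      unfolding a power2_eq_square by (subst (2) b) (simp add: algebra_simps)
    then show ?thesis by (simp add: t_def algebra_simps)
  qed
  then have "bessel_sum (x / 2) (\<nu> - 1) * bessel_sum (x / 2) (\<nu> + 1) < (bessel_sum (x / 2) \<nu>)\<^sup>2"
    using assms by (intro bessel_sum_turan_less) auto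
  then have "(exp (- x) * 2 powr (- \<nu>))\<^sup>2 * (bessel_sum (x / 2) (\<nu> - 1) * bessel_sum (x / 2) (\<nu> + 1))
      < (exp (- x) * 2 powr (- \<nu>))\<^sup>2 * (bessel_sum (x / 2) \<nu>)\<^sup>2"
    by (intro mult_strict_left_mono) auto
  moreover have "2 powr (- (\<nu> - 1)) * 2 powr (- (\<nu> + 1)) = (2 powr (- \<nu>))\<^sup>2"
    by (simp add: power2_eq_square flip: powr_add)
  moreover have e: "(E * P * A) * (E * Q * B) = E\<^sup>2 * (P * Q) * (A * B)" for E P Q A B :: real
    by (simp add: power2_eq_square)
  ultimately show ?thesis
    unfolding Phi_eq_bessel_sum[OF assms(2)] e by (simp only: power_mult_distrib)
qed

section \<open>Midpoint inequalities and log-concavity of \<open>Phi\<close> in the order\<close>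

lemma log_convex_on_midpoint:
  assumes "log_convex_on J f" "a \<in> J" "b \<in> J"
  shows "(f ((a + b) / 2))\<^sup>2 \<le> f a * f b"
proof -
  have conv: "convex_on J (\<lambda>t. ln (f t))" and pos: "\<And>t. t \<in> J \<Longrightarrow> f t > 0"
    using assms(1) by (auto simp: log_convex_on_def)
  have mid: "(a + b) / 2 \<in> J"
    using convexD[OF convex_on_imp_convex[OF conv] assms(2,3), of "1/2" "1/2"] by (simp add: field_simps)
  note p = pos[OF assms(2)] pos[OF assms(3)] pos[OF mid]
  have "ln (f ((a + b) / 2)) \<le> 1/2 * ln (f a) + 1/2 * ln (f b)"
    using convex_onD[OF conv, of "1/2" a b] assms(2,3) by (simp add: field_simps)
  then have "ln ((f ((a + b) / 2))\<^sup>2) \<le> ln (f a * f b)"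
    using p by (simp add: ln_mult_pos ln_realpow)
  then show ?thesis using p by (subst (asm) ln_le_cancel_iff) simp_all
qed

lemma log_convex_on_Gamma: "log_convex_on {0<..} Gamma"
  using log_convex_Gamma_real by (simp add: log_convex_on_def o_def)

text \<open>Log-convexity of \<open>Gamma\<close> at the midpoint turns into the required
  \<open>rGamma\<close> comparison on taking reciprocals.\<close>

lemma bessel_sum_midpoint:
  assumes "\<mu> > -1" "\<nu> > -1" "y > 0"
  shows "bessel_sum y \<mu> * bessel_sum y \<nu> \<le> (bessel_sum y ((\<mu> + \<nu>) / 2))\<^sup>2"
proof (rule bessel_sum_turan_le)
  fix k
  let ?a = "real k + \<mu> + 1" and ?b = "real k + \<nu> + 1"
  have *: "?a > 0" "?b > 0" using assms by auto
  have "(?a + ?b) / 2 = real k + (\<mu> + \<nu>) / 2 + 1" by (simp add: field_simps)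
  with log_convex_on_midpoint[OF log_convex_on_Gamma, of ?a ?b] *
  have le: "(Gamma (real k + (\<mu> + \<nu>) / 2 + 1))\<^sup>2 \<le> Gamma ?a * Gamma ?b" by (simp only: greaterThan_iff)
  have "0 < (Gamma (real k + (\<mu> + \<nu>) / 2 + 1))\<^sup>2" using * by (intro zero_less_power Gamma_real_pos) (simp add: field_simps)
  from le_imp_inverse_le[OF le this] show
    "rGamma ?a * rGamma ?b \<le> (rGamma (real k + (\<mu> + \<nu>) / 2 + 1))\<^sup>2"
    by (simp add: rGamma_inverse_Gamma power_inverse mult.commute)
qed (use assms in auto)

text \<open>The least minimiser of the function minus its chord is an interior point whenever the
  minimum is negative, and this contradicts midpoint concavity there.\<close>
lemma midpoint_concave_imp_concave_on:
  fixes f :: "real \<Rightarrow> real"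
  assumes "convex S" "continuous_on S f"
    and mid: "\<And>x y. x \<in> S \<Longrightarrow> y \<in> S \<Longrightarrow> (f x + f y) / 2 \<le> f ((x + y) / 2)"
  shows "concave_on S f"
proof -
  have main: "(1 - t) * f a + t * f b \<le> f ((1 - t) * a + t * b)"
    if "a \<in> S" "b \<in> S" "a < b" "0 < t" "t < 1" for a b t
  proof (rule ccontr)
    assume neg: "\<not> ?thesis"
    have sub: "{a..b} \<subseteq> S"
      using \<open>convex S\<close> that by (simp add: closed_segment_subset flip: closed_segment_eq_real_ivl1)
    \<comment> \<open>The slope of the chord; subtracting the chord makes \<open>g\<close> vanish at
      both ends.\<close>
    define K where "K = (f b - f a) / (b - a)"
    define g where "g s = f s - f a - (s - a) * K" for s
    have K: "(b - a) * K = f b - f a" using that by (simp add: K_def)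
    have ga: "g a = 0" and gb: "g b = 0" by (simp_all add: g_def K)
    have cont: "continuous_on {a..b} g"
      unfolding g_def by (intro continuous_intros continuous_on_subset[OF assms(2) sub])
    have gmid: "(g x + g y) / 2 \<le> g ((x + y) / 2)" if "x \<in> {a..b}" "y \<in> {a..b}" for x y
    proof -
      have "(g x + g y) / 2 = (f x + f y) / 2 - f a - ((x + y) / 2 - a) * K"
        by (simp add: g_def field_simps)
      moreover have "(f x + f y) / 2 \<le> f ((x + y) / 2)" using mid sub that by blast
      ultimately show ?thesis by (simp add: g_def)
    qed
    define p where "p = (1 - t) * a + t * b"
    have p: "p \<in> {a..b}"
      using convexD_alt[of "{a..b}" a b t] that by (auto simp: p_def)
    have "(p - a) * K = t * ((b - a) * K)" by (simp add: p_def algebra_simps)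
    then have gp: "g p < 0" using neg unfolding K g_def p_def by (simp add: algebra_simps)
    obtain q where q: "q \<in> {a..b}" "\<And>s. s \<in> {a..b} \<Longrightarrow> g q \<le> g s"
      using continuous_attains_inf[OF _ _ cont] p by auto
    define Z where "Z = {s \<in> {a..b}. g s = g q}"
    have "closed Z"
      unfolding Z_def by (rule continuous_closed_preimage_constant[OF cont]) auto
    then have "compact Z" by (rule compact_eq_bounded_closed[THEN iffD2, OF conjI, rotated])
        (auto simp: Z_def intro: bounded_subset[OF bounded_closed_interval])
    moreover have "Z \<noteq> {}" using q by (auto simp: Z_def)
    ultimately obtain c where c: "c \<in> Z" "\<And>s. s \<in> Z \<Longrightarrow> c \<le> s"
      using compact_attains_inf by metis
    have gc: "g c < 0" using c(1) q(2)[OF p] gp by (auto simp: Z_def)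
    have cin: "a < c" "c < b"
      using c(1) gc ga gb by (auto simp: Z_def less_le)
    define h where "h = min (c - a) (b - c)"
    have h: "h > 0" "c - h \<in> {a..b}" "c + h \<in> {a..b}" using cin by (auto simp: h_def)
    \<comment> \<open>The point \<open>c - h\<close> lies to the left of the least minimiser, so the
      inequality there is strict and the midpoint inequality at \<open>c\<close> fails.\<close>
    have "g (c - h) \<noteq> g c" using c h by (force simp: Z_def)
    moreover have "g c \<le> g (c - h)" "g c \<le> g (c + h)" using q(2) h c(1) by (auto simp: Z_def)
    ultimately show False using gmid[OF h(2,3)] by simp
  qed
  show ?thesis
    unfolding concave_on_def
  proof (rule convex_on_linorderI)
    show "- f ((1 - t) *\<^sub>R x + t *\<^sub>R y) \<le> (1 - t) * - f x + t * - f y"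
      if "0 < t" "t < 1" "x \<in> S" "y \<in> S" "x < y" for t x y
      using main[of x y t] that by simp
  qed (rule \<open>convex S\<close>)
qed

lemma convex_on_cong:
  assumes "\<And>x. x \<in> S \<Longrightarrow> f x = g x"
  shows "convex_on S f \<longleftrightarrow> convex_on S g"
  unfolding convex_on_def using assms by (auto simp: convex_def)

lemma log_concave_Phi:
  assumes "x > 0"
  shows "log_concave_on {-1<..} (\<lambda>\<nu>. Phi \<nu> x)"
proof -
  let ?S = "bessel_sum (x / 2)"
  have pos: "?S \<nu> > 0" if "\<nu> > -1" for \<nu> using bessel_sum_pos assms that by simp
  have cont: "continuous_on {-1<..} ?S"
    unfolding bessel_sum_def
    by (intro continuous_intros continuous_on_bessel_clifford
        continuous_on_compose2[OF continuous_on_bessel_clifford[of UNIV]]) auto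
  define h where "h \<nu> = (- x + - \<nu> * ln 2) + ln (?S \<nu>)" for \<nu>
  have ln_eq: "ln (Phi \<nu> x) = h \<nu>" if "\<nu> > -1" for \<nu>
    unfolding h_def Phi_eq_bessel_sum[OF assms] using pos[OF that] by (simp add: ln_mult ln_powr)
  have "concave_on {-1<..} (\<lambda>\<nu>. ln (?S \<nu>))"
  proof (rule midpoint_concave_imp_concave_on)
    show "continuous_on {-1<..} (\<lambda>\<nu>. ln (?S \<nu>))"
      using pos by (intro continuous_on_ln cont) force
    fix a b :: real assume ab: "a \<in> {-1<..}" "b \<in> {-1<..}"
    then have p: "?S a > 0" "?S b > 0" "?S ((a + b) / 2) > 0" by (auto intro!: pos)
    have "ln (?S a * ?S b) \<le> ln ((?S ((a + b) / 2))\<^sup>2)"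
      using bessel_sum_midpoint[of a b "x / 2"] ab p assms by (subst ln_le_cancel_iff) auto
    then show "(ln (?S a) + ln (?S b)) / 2 \<le> ln (?S ((a + b) / 2))"
      using p by (simp add: ln_mult ln_realpow)
  qed simp
  moreover have "concave_on {-1<..} (\<lambda>\<nu>. - x + - \<nu> * ln 2)"
    by (rule f''_le0_imp_concave[where f' = "\<lambda>_. - ln 2" and f'' = "\<lambda>_. 0"])
      (auto intro!: derivative_eq_intros)
  ultimately have "concave_on {-1<..} h"
    unfolding h_def by (rule concave_on_add[rotated])
  moreover have "concave_on {-1<..} (\<lambda>\<nu>. ln (Phi \<nu> x)) \<longleftrightarrow> concave_on {-1<..} h"
    unfolding concave_on_def by (rule convex_on_cong) (simp add: ln_eq)
  moreover have "Phi \<nu> x > 0" if "\<nu> > -1" for \<nu>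
    unfolding Phi_eq_bessel_sum[OF assms] using pos[OF that] by simp
  ultimately show ?thesis by (simp add: log_concave_on_def)
qed

subsection \<open>Laplace transforms of positive measures\<close>

text \<open>Replaces iterated \<open>deriv\<close> by an explicit family: \<open>g m\<close> stands
  for (-1)^m times the m-th derivative.\<close>

lemma completely_monotonic_onI:
  assumes "open J"
    and deriv: "\<And>m t. t \<in> J \<Longrightarrow> (g m has_real_derivative - g (Suc m) t) (at t)"
    and nonneg: "\<And>m t. t \<in> J \<Longrightarrow> g m t \<ge> 0"
    and eq: "\<And>t. t \<in> J \<Longrightarrow> f t = g 0 t"
  shows "completely_monotonic_on J f"
proof -
  \<comment> \<open>Proved jointly: D at m yields E at m + 1 throughout J, and since J is open the
    formula can then be differentiated to give D at m + 1.\<close>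
  have D: "((deriv ^^ m) f has_real_derivative (- 1) ^ Suc m * g (Suc m) t) (at t)"
    and E: "(deriv ^^ m) f t = (- 1) ^ m * g m t" if "t \<in> J" for m t
    using that
  proof (induction m arbitrary: t)
    case 0
    { case 1
      have "(f has_real_derivative - g (Suc 0) t) (at t)"
        by (rule has_field_derivative_transform_within_open[OF deriv \<open>open J\<close>]) (use 1 eq in auto)
      then show ?case by simp
    next
      case 2
      then show ?case by (simp add: eq)
    }
  next
    case (Suc m)
    have E: "(deriv ^^ Suc m) f t = (- 1) ^ Suc m * g (Suc m) t" if "t \<in> J" for t
      using DERIV_imp_deriv[OF Suc(1)[OF that]] by simp
    { case 1
      have "((\<lambda>t. (- 1) ^ Suc m * g (Suc m) t) has_real_derivative (- 1) ^ Suc m * - g (Suc (Suc m)) t) (at t)"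
        by (intro DERIV_cmult deriv 1)
      then have "((deriv ^^ Suc m) f has_real_derivative (- 1) ^ Suc m * - g (Suc (Suc m)) t) (at t)"
        by (rule has_field_derivative_transform_within_open[OF _ \<open>open J\<close> 1]) (rule E[symmetric])
      then show ?case by simp
    next
      case 2
      then show ?case by (rule E)
    }
  qed
  show ?thesis
    unfolding completely_monotonic_on_def real_differentiable_def
  proof (intro conjI allI ballI)
    fix m t assume t: "t \<in> J"
    show "\<exists>f'. ((deriv ^^ m) f has_real_derivative f') (at t)" using D[OF t] by blast
    have "(- 1) ^ m * (deriv ^^ m) f t = g m t"
      unfolding E[OF t] by (simp flip: mult.assoc power_mult_distrib)
    then show "0 \<le> (- 1) ^ m * (deriv ^^ m) f t" using nonneg[OF t] by simp
  qed
qed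

text \<open>Half of the gap c - c0 pays for the extra factor: \<theta> <= exp (d * \<theta>) / d,
  and c - d still exceeds c0.\<close>

lemma integrable_laplace_mult:
  fixes w \<theta> :: "'a \<Rightarrow> real"
  assumes [measurable]: "\<theta> \<in> borel_measurable M"
    and \<theta>: "\<And>u. u \<in> space M \<Longrightarrow> \<theta> u \<ge> 0"
    and int: "\<And>c. c > c0 \<Longrightarrow> integrable M (\<lambda>u. w u * exp (- c * \<theta> u))"
    and c: "c > c0"
  shows "integrable M (\<lambda>u. w u * \<theta> u * exp (- c * \<theta> u))"
proof -
  define d where "d = (c - c0) / 2"
  have d: "d > 0" "c - d > c0" using c by (simp_all add: d_def field_simps)
  have [measurable]: "(\<lambda>u. w u * exp (- c * \<theta> u)) \<in> borel_measurable M" using int[OF c] by simp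
  show ?thesis
  proof (rule Bochner_Integration.integrable_bound)
    show "integrable M (\<lambda>u. w u * exp (- (c - d) * \<theta> u) / d)"
      using int[OF d(2)] by simp
    have "(\<lambda>u. (w u * exp (- c * \<theta> u)) * \<theta> u) \<in> borel_measurable M" by measurable
    then show "(\<lambda>u. w u * \<theta> u * exp (- c * \<theta> u)) \<in> borel_measurable M" by (simp add: mult_ac)
    show "AE u in M. norm (w u * \<theta> u * exp (- c * \<theta> u)) \<le> norm (w u * exp (- (c - d) * \<theta> u) / d)"
    proof (rule AE_I2)
      fix u assume "u \<in> space M"
      then have "\<theta> u \<ge> 0" by (rule \<theta>)
      have "d * \<theta> u \<le> exp (d * \<theta> u)" using exp_ge_add_one_self[of "d * \<theta> u"] by linarith
      then have "\<theta> u \<le> exp (d * \<theta> u) / d" using d by (simp add: field_simps)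
      then have "\<bar>w u\<bar> * exp (- c * \<theta> u) * \<theta> u \<le> \<bar>w u\<bar> * exp (- c * \<theta> u) * (exp (d * \<theta> u) / d)"
        by (rule mult_left_mono) simp
      also have "\<dots> = \<bar>w u\<bar> * exp (- (c - d) * \<theta> u) / d"
        by (simp add: algebra_simps flip: exp_add)
      finally show "norm (w u * \<theta> u * exp (- c * \<theta> u)) \<le> norm (w u * exp (- (c - d) * \<theta> u) / d)"
        using \<open>\<theta> u \<ge> 0\<close> d by (simp add: abs_mult mult_ac)
    qed
  qed
qed

text \<open>Follows from 1 + t <= exp t; it dominates the difference quotients of the Laplace
  kernel.\<close>

lemma exp_diff_le_lipschitz:
  fixes a b c :: real
  assumes "a \<le> c" "b \<le> c"
  shows "\<bar>exp a - exp b\<bar> \<le> \<bar>a - b\<bar> * exp c"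
proof -
  have *: "exp x - exp y \<le> \<bar>x - y\<bar> * exp c" if "x \<le> c" for x y
  proof -
    have "(1 + (y - x)) * exp x \<le> exp (y - x) * exp x"
      by (intro mult_right_mono exp_ge_add_one_self) simp
    then have "exp x - exp y \<le> (x - y) * exp x" by (simp add: algebra_simps flip: exp_add)
    also have "\<dots> \<le> \<bar>x - y\<bar> * exp c" using that by (intro mult_mono) auto
    finally show ?thesis .
  qed
  show ?thesis using *[OF assms(1), of b] *[OF assms(2), of a] by (simp add: abs_le_iff abs_minus_commute)
qed

text \<open>Differentiation under the integral sign, by dominated convergence along arbitrary
  sequences tending to c.\<close>

lemma laplace_has_real_derivative:
  fixes w \<theta> :: "'a \<Rightarrow> real"
  assumes \<theta>m [measurable]: "\<theta> \<in> borel_measurable M"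
    and \<theta>: "\<And>u. u \<in> space M \<Longrightarrow> \<theta> u \<ge> 0"
    and int: "\<And>c. c > c0 \<Longrightarrow> integrable M (\<lambda>u. w u * exp (- c * \<theta> u))"
    and c: "c > c0"
  shows "((\<lambda>c. \<integral>u. w u * exp (- c * \<theta> u) \<partial>M) has_real_derivative
    - (\<integral>u. w u * \<theta> u * exp (- c * \<theta> u) \<partial>M)) (at c)"
proof -
  \<comment> \<open>Strictly between c0 and c: all exponents beyond a share one integrable majorant,
    and {a<..} is still a neighbourhood of c.\<close>
  define a where "a = (c + c0) / 2"
  have a: "a > c0" "c \<in> {a<..}" using c by (simp_all add: a_def field_simps)
  let ?G = "\<lambda>c. \<integral>u. w u * exp (- c * \<theta> u) \<partial>M"
  let ?D = "\<integral>u. w u * \<theta> u * exp (- c * \<theta> u) \<partial>M"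
  have "((\<lambda>y. (?G y - ?G c) / (y - c)) \<longlongrightarrow> - ?D) (at c within {a<..})"
    unfolding tendsto_at_iff_sequentially comp_def
  proof (intro allI impI)
    fix X :: "nat \<Rightarrow> real"
    assume X: "\<forall>i. X i \<in> {a<..} - {c}" and lim: "X \<longlonglongrightarrow> c"
    define q where "q i u = (w u * exp (- X i * \<theta> u) - w u * exp (- c * \<theta> u)) / (X i - c)" for i u
    have intX: "integrable M (\<lambda>u. w u * exp (- X i * \<theta> u))" for i
    proof (rule int)
      show "X i > c0" using X[rule_format, of i] a by simp
    qed
    have "(\<lambda>i. \<integral>u. q i u \<partial>M) \<longlonglongrightarrow> (\<integral>u. - (w u * \<theta> u * exp (- c * \<theta> u)) \<partial>M)"
    proof (rule integral_dominated_convergence)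
      show "integrable M (\<lambda>u. \<bar>w u * \<theta> u * exp (- a * \<theta> u)\<bar>)"
        using integrable_laplace_mult[OF \<theta>m \<theta> int a(1)] by (rule integrable_abs)
      show "(\<lambda>u. - (w u * \<theta> u * exp (- c * \<theta> u))) \<in> borel_measurable M"
        by (intro borel_measurable_uminus borel_measurable_integrable integrable_laplace_mult[OF \<theta>m \<theta> int c])
      show "q i \<in> borel_measurable M" for i
        using intX[of i] int[OF c] unfolding q_def
        by (intro borel_measurable_divide borel_measurable_diff) auto
      show "AE u in M. (\<lambda>i. q i u) \<longlonglongrightarrow> - (w u * \<theta> u * exp (- c * \<theta> u))"
      proof (rule AE_I2)
        fix u
        have "((\<lambda>y. w u * exp (- y * \<theta> u)) has_real_derivative - (w u * \<theta> u * exp (- c * \<theta> u)))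
            (at c within {a<..})"
          by (auto intro!: derivative_eq_intros)
        from this[unfolded has_field_derivative_iff tendsto_at_iff_sequentially comp_def,
            THEN spec, THEN mp, THEN mp, OF X lim]
        show "(\<lambda>i. q i u) \<longlonglongrightarrow> - (w u * \<theta> u * exp (- c * \<theta> u))"
          unfolding q_def .
      qed
      show "AE u in M. norm (q i u) \<le> \<bar>w u * \<theta> u * exp (- a * \<theta> u)\<bar>" for i
      proof (rule AE_I2)
        fix u assume "u \<in> space M"
        then have t: "\<theta> u \<ge> 0" by (rule \<theta>)
        have Xi: "a \<le> X i" "X i \<noteq> c" using X by (auto simp: less_imp_le)
        have "\<bar>exp (- X i * \<theta> u) - exp (- c * \<theta> u)\<bar> \<le> \<bar>- X i * \<theta> u - - c * \<theta> u\<bar> * exp (- a * \<theta> u)"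
          using t Xi a by (intro exp_diff_le_lipschitz) (auto intro: mult_right_mono)
        also have "- X i * \<theta> u - - c * \<theta> u = (c - X i) * \<theta> u"
          by (simp add: algebra_simps)
        also have "\<bar>(c - X i) * \<theta> u\<bar> = \<bar>X i - c\<bar> * \<theta> u"
          using t by (simp add: abs_mult abs_minus_commute[of c])
        finally have "\<bar>exp (- X i * \<theta> u) - exp (- c * \<theta> u)\<bar> / \<bar>X i - c\<bar> \<le> \<theta> u * exp (- a * \<theta> u)"
          using Xi by (simp add: pos_divide_le_eq mult_ac)
        then have "\<bar>w u\<bar> * (\<bar>exp (- X i * \<theta> u) - exp (- c * \<theta> u)\<bar> / \<bar>X i - c\<bar>)
            \<le> \<bar>w u\<bar> * (\<theta> u * exp (- a * \<theta> u))"
          by (rule mult_left_mono) simp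
        moreover have "q i u = w u * ((exp (- X i * \<theta> u) - exp (- c * \<theta> u)) / (X i - c))"
          by (simp add: q_def right_diff_distrib)
        ultimately show "norm (q i u) \<le> \<bar>w u * \<theta> u * exp (- a * \<theta> u)\<bar>"
          using t by (simp add: abs_mult)
      qed
    qed
    moreover have "(\<integral>u. q i u \<partial>M) = (?G (X i) - ?G c) / (X i - c)" for i
      unfolding q_def using intX[of i] int[OF c] by simp
    ultimately show "(\<lambda>i. (?G (X i) - ?G c) / (X i - c)) \<longlonglongrightarrow> - ?D"
      by simp
  qed
  then have "(?G has_real_derivative - ?D) (at c within {a<..})"
    unfolding has_field_derivative_iff .
  then show ?thesis using at_within_open[OF a(2) open_greaterThan] by (simp only:)
qed

context
  fixes M :: "'a measure" and w \<theta> :: "'a \<Rightarrow> real" and c0 :: real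
  assumes \<theta>m: "\<theta> \<in> borel_measurable M"
    and \<theta>: "\<And>u. u \<in> space M \<Longrightarrow> \<theta> u \<ge> 0"
    and w: "\<And>u. u \<in> space M \<Longrightarrow> w u \<ge> 0"
    and int: "\<And>c. c > c0 \<Longrightarrow> integrable M (\<lambda>u. w u * exp (- c * \<theta> u))"
begin

text \<open>For c > c0 this is (-1)^m times the m-th derivative of the Laplace transform.\<close>

definition laplace_moment :: "nat \<Rightarrow> real \<Rightarrow> real" where
  "laplace_moment m c = (\<integral>u. w u * \<theta> u ^ m * exp (- c * \<theta> u) \<partial>M)"

lemma integrable_laplace_moment:
  "c > c0 \<Longrightarrow> integrable M (\<lambda>u. w u * \<theta> u ^ m * exp (- c * \<theta> u))"
proof (induction m arbitrary: c)
  case (Suc m)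
  from integrable_laplace_mult[OF \<theta>m \<theta> Suc.IH Suc.prems] show ?case by (simp add: mult_ac)
qed (use int in simp)

lemma laplace_moment_nonneg: "laplace_moment m c \<ge> 0"
  unfolding laplace_moment_def using w \<theta> by (intro Bochner_Integration.integral_nonneg) auto

text \<open>The derivative formula for order zero, applied with w * \<theta>^m as the
  weight.\<close>

lemma laplace_moment_has_real_derivative:
  "c > c0 \<Longrightarrow> (laplace_moment m has_real_derivative - laplace_moment (Suc m) c) (at c)"
  using laplace_has_real_derivative[OF \<theta>m \<theta> integrable_laplace_moment[of _ m]]
  by (simp only: laplace_moment_def[abs_def] power_Suc2 mult.assoc)

text \<open>Integrate the nonnegative w * exp (- c * \<theta>) * (a * \<theta> - b)^2, with a and b
  the moments 0 and 1. The surplus factor a avoids a division; it is cancelled once the moment is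
  known to be positive.\<close>

lemma laplace_moment_cauchy_schwarz:
  assumes c: "c > c0"
  shows "laplace_moment 0 c * (laplace_moment 1 c)\<^sup>2 \<le> (laplace_moment 0 c)\<^sup>2 * laplace_moment 2 c"
proof -
  let ?a = "laplace_moment 0 c" and ?b = "laplace_moment 1 c"
  let ?h = "\<lambda>m u. w u * \<theta> u ^ m * exp (- c * \<theta> u)"
  have "0 \<le> (\<integral>u. w u * exp (- c * \<theta> u) * (?a * \<theta> u - ?b)\<^sup>2 \<partial>M)"
    using w by (intro Bochner_Integration.integral_nonneg) auto
  also have "\<dots> = (\<integral>u. ?a\<^sup>2 * ?h 2 u - 2 * ?a * ?b * ?h 1 u + ?b\<^sup>2 * ?h 0 u \<partial>M)"
    by (rule Bochner_Integration.integral_cong) (simp_all add: power2_eq_square algebra_simps)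
  also have "\<dots> = ?a\<^sup>2 * laplace_moment 2 c - 2 * ?a * ?b * ?b + ?b\<^sup>2 * ?a"
    unfolding laplace_moment_def[of 2] laplace_moment_def[of 1 c] laplace_moment_def[of 0 c]
    using integrable_laplace_moment[OF c, of 0] integrable_laplace_moment[OF c, of 1]
      integrable_laplace_moment[OF c, of 2]
    by simp
  finally show ?thesis by (simp add: power2_eq_square algebra_simps)
qed

lemma completely_monotonic_laplace:
  assumes "\<And>c. c > c0 \<Longrightarrow> f c = (\<integral>u. w u * exp (- c * \<theta> u) \<partial>M)"
  shows "completely_monotonic_on {c0<..} f"
proof (rule completely_monotonic_onI)
  show "(laplace_moment m has_real_derivative - laplace_moment (Suc m) c) (at c)"
    if "c \<in> {c0<..}" for m c
    using laplace_moment_has_real_derivative that by simp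
  show "f c = laplace_moment 0 c" if "c \<in> {c0<..}" for c
    using assms that by (simp add: laplace_moment_def)
qed (simp_all add: laplace_moment_nonneg)

text \<open>The second derivative of the logarithm has numerator L2 * L0 - L1^2 in the moments,
  nonnegative by Cauchy--Schwarz.\<close>

lemma log_convex_laplace:
  assumes f: "\<And>c. c > c0 \<Longrightarrow> f c = (\<integral>u. w u * exp (- c * \<theta> u) \<partial>M)"
    and pos: "\<And>c. c > c0 \<Longrightarrow> f c > 0"
  shows "log_convex_on {c0<..} f"
proof -
  let ?L = "laplace_moment"
  have f0: "f c = ?L 0 c" if "c > c0" for c using f[OF that] by (simp add: laplace_moment_def)
  have pos0: "?L 0 c > 0" if "c > c0" for c using pos[OF that] f0[OF that] by simp
  have "convex_on {c0<..} (\<lambda>c. ln (?L 0 c))"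
  proof (rule f''_ge0_imp_convex)
    fix c assume "c \<in> {c0<..}"
    then have c: "c > c0" by simp
    note p = pos0[OF c]
    show "((\<lambda>c. ln (?L 0 c)) has_real_derivative - ?L 1 c / ?L 0 c) (at c)"
      using laplace_moment_has_real_derivative[OF c, of 0] p
      by (auto intro!: derivative_eq_intros)
    show "((\<lambda>c. - ?L 1 c / ?L 0 c) has_real_derivative
        (?L 2 c * ?L 0 c - (?L 1 c)\<^sup>2) / (?L 0 c)\<^sup>2) (at c)"
      using laplace_moment_has_real_derivative[OF c, of 0] laplace_moment_has_real_derivative[OF c, of 1] p
      by (auto intro!: derivative_eq_intros simp: power2_eq_square eval_nat_numeral field_simps)
    have "?L 0 c * (?L 1 c)\<^sup>2 \<le> ?L 0 c * (?L 0 c * ?L 2 c)"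
      using laplace_moment_cauchy_schwarz[OF c] by (simp add: power2_eq_square mult_ac)
    then show "0 \<le> (?L 2 c * ?L 0 c - (?L 1 c)\<^sup>2) / (?L 0 c)\<^sup>2"
      using p by (simp add: mult_ac)
  qed simp
  then have "convex_on {c0<..} (\<lambda>c. ln (f c))"
    by (subst convex_on_cong[of _ _ "\<lambda>c. ln (?L 0 c)"]) (simp_all add: f0)
  then show ?thesis using pos by (simp add: log_convex_on_def)
qed

end

subsection \<open>Sonine integral and the Laplace representation of Psi\<close>

lemma has_bochner_integral_Beta_real:
  assumes "a > 0" "b > (0::real)"
  shows "has_bochner_integral (lebesgue_on {0<..<1}) (\<lambda>u. u powr (a - 1) * (1 - u) powr (b - 1)) (Beta a b)"
proof -
  let ?f = "\<lambda>u::real. u powr (a - 1) * (1 - u) powr (b - 1)"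
  have I: "(?f has_integral Beta a b) {0<..<1}"
    using has_integral_Beta_real[OF assms] by (simp add: has_integral_Icc_iff_Ioo)
  then have "?f absolutely_integrable_on {0<..<1}"
    by (intro nonnegative_absolutely_integrable_1) auto
  then have int: "integrable (lebesgue_on {0<..<1}) ?f"
    by (rule absolutely_integrable_imp_integrable) simp
  moreover have "integral\<^sup>L (lebesgue_on {0<..<1}) ?f = Beta a b"
    using lebesgue_integral_eq_integral[OF int] I by (simp add: integral_unique)
  ultimately show ?thesis by (simp add: has_bochner_integral_iff)
qed

text \<open>Termwise integration: the factor Beta (k + q) s turns rGamma (k + q) into Gamma s *
  rGamma (k + q + s), raising the order by s. All terms are nonnegative, so the sum of the integrals
  also gives the absolute summability that justifies the interchange.\<close>

lemma bessel_clifford_sonine: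
  assumes s: "s > 0" and q: "q > 0" and z: "z \<ge> 0"
  shows "has_bochner_integral (lebesgue_on {0<..<1})
    (\<lambda>u. bessel_clifford (q - 1) (z * u) * (u powr (q - 1) * (1 - u) powr (s - 1)))
    (Gamma s * bessel_clifford (s + q - 1) z)"
proof -
  let ?M = "lebesgue_on {0<..<1::real}"
  define c where "c k = rGamma (real k + q) / fact k * z ^ k" for k
  define f where "f k u = c k * (u powr (real k + q - 1) * (1 - u) powr (s - 1))" for k u
  have c_nonneg: "c k \<ge> 0" for k
    using q z unfolding c_def by (intro mult_nonneg_nonneg) (auto simp: rGamma_inverse_Gamma intro: less_imp_le)
  have f_int: "has_bochner_integral ?M (f k)
      (Gamma s * (rGamma (real k + (s + q - 1) + 1) / fact k * z ^ k))" for k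
  proof -
    have "has_bochner_integral ?M (f k) (c k * Beta (real k + q) s)"
      unfolding f_def[abs_def]
      by (intro has_bochner_integral_mult_right has_bochner_integral_Beta_real) (use s q in auto)
    moreover have "c k * Beta (real k + q) s = Gamma s * (rGamma (real k + (s + q - 1) + 1) / fact k * z ^ k)"
      using Gamma_real_pos[of "real k + q"] q
      by (simp add: c_def Beta_def rGamma_inverse_Gamma field_simps del: Gamma_real_pos)
    ultimately show ?thesis by simp
  qed
  have f_sums: "(\<lambda>k. f k u) sums (bessel_clifford (q - 1) (z * u) * (u powr (q - 1) * (1 - u) powr (s - 1)))"
    if "u \<in> {0<..<1}" for u
  proof -
    have "f k u = rGamma (real k + (q - 1) + 1) / fact k * (z * u) ^ k * (u powr (q - 1) * (1 - u) powr (s - 1))" for k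
    proof -
      have "u powr (real k + q - 1) = u ^ k * u powr (q - 1)"
        using that powr_add[of u "real k" "q - 1"] by (simp add: powr_realpow add_diff_eq)
      then show ?thesis by (simp add: f_def c_def power_mult_distrib)
    qed
    then show ?thesis by (simp only: sums_mult2[OF bessel_clifford_sums])
  qed
  have f_nonneg: "f k u \<ge> 0" for k u
    unfolding f_def using c_nonneg by (intro mult_nonneg_nonneg) auto
  have int: "integrable ?M (f k)" for k using f_int[of k] by (rule integrable.intros)
  have sumI: "(\<lambda>k. integral\<^sup>L ?M (f k)) sums (Gamma s * bessel_clifford (s + q - 1) z)"
    using sums_mult[OF bessel_clifford_sums, of "Gamma s" "s + q - 1" z]
      has_bochner_integral_integral_eq[OF f_int] by simp
  have AE: "AE u in ?M. summable (\<lambda>k. norm (f k u))"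
    using f_sums f_nonneg by (intro AE_I2) (auto simp: sums_iff)
  have norms: "summable (\<lambda>k. \<integral>u. norm (f k u) \<partial>?M)"
    using sumI f_nonneg by (simp add: sums_iff)
  have "has_bochner_integral ?M (\<lambda>u. \<Sum>k. f k u) (Gamma s * bessel_clifford (s + q - 1) z)"
    using integrable_suminf[OF int AE norms] integral_suminf[OF int AE norms] sumI
    by (simp add: has_bochner_integral_iff sums_iff)
  then show ?thesis
    by (rule has_bochner_integral_cong[THEN iffD1, rotated -1]) (use f_sums in \<open>auto simp: sums_iff\<close>)
qed

text \<open>Sonine's integral with s = \<nu> + 1/2 is used for q = 1/2 and q = 3/2, giving the
  orders \<nu> and \<nu> + 1 with the same power (1 - u) powr (s - 1). Only (1 - u) powr \<nu> = exp
  (- \<nu> * \<theta> u) involves \<nu>; the normalisation of \<open>Psi\<close> supplies the factor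
  Gamma s and cancels 2 powr (- \<nu>).\<close>

lemma Psi_laplace:
  assumes x: "x > 0"
  obtains w \<theta> :: "real \<Rightarrow> real"
  where "\<theta> \<in> borel_measurable (lebesgue_on {0<..<1})"
    "\<And>u. u \<in> space (lebesgue_on {0<..<1}) \<Longrightarrow> \<theta> u \<ge> 0"
    "\<And>u. u \<in> space (lebesgue_on {0<..<1}) \<Longrightarrow> w u \<ge> 0"
    "\<And>\<nu>. \<nu> > -1/2 \<Longrightarrow> has_bochner_integral (lebesgue_on {0<..<1}) (\<lambda>u. w u * exp (- \<nu> * \<theta> u)) (Psi \<nu> x)"
proof -
  let ?M = "lebesgue_on {0<..<1::real}"
  define y where "y = x / 2"
  define W where "W q u = bessel_clifford (q - 1) (y\<^sup>2 * u) * u powr (q - 1)" for q u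
  define w where "w u = sqrt pi * exp (- x) * (W (1/2) u + y * W (3/2) u) * (1 - u) powr (- 1/2)" for u
  define \<theta> where "\<theta> u = - ln (1 - u)" for u :: real
  have y: "y > 0" using x by (simp add: y_def)
  show ?thesis
  proof (rule that)
    show "\<theta> \<in> borel_measurable ?M"
      unfolding \<theta>_def
      by (intro continuous_imp_measurable_on_sets_lebesgue continuous_intros) auto
    show "\<theta> u \<ge> 0" if "u \<in> space ?M" for u using that by (simp add: \<theta>_def)
    show "w u \<ge> 0" if "u \<in> space ?M" for u
    proof -
      have "W q u \<ge> 0" if "q > 0" for q
        using that \<open>u \<in> space ?M\<close> bessel_clifford_pos[of "q - 1" "y\<^sup>2 * u"] by (simp add: W_def)
      then show ?thesis using y by (simp add: w_def)
    qed
    fix \<nu> :: real assume \<nu>: "\<nu> > -1/2"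
    define s where "s = \<nu> + 1/2"
    have s: "s > 0" using \<nu> by (simp add: s_def)
    have W: "has_bochner_integral ?M (\<lambda>u. W q u * (1 - u) powr (s - 1))
        (Gamma s * bessel_clifford (s + q - 1) (y\<^sup>2))" if "q > 0" for q
      using bessel_clifford_sonine[OF s that, of "y\<^sup>2"] by (simp add: W_def mult.assoc)
    have I: "has_bochner_integral ?M
        (\<lambda>u. sqrt pi * exp (- x) * (W (1/2) u * (1 - u) powr (s - 1) + y * (W (3/2) u * (1 - u) powr (s - 1))))
        (sqrt pi * exp (- x) * (Gamma s * bessel_clifford (s + 1/2 - 1) (y\<^sup>2)
          + y * (Gamma s * bessel_clifford (s + 3/2 - 1) (y\<^sup>2))))"
      by (intro has_bochner_integral_mult_right has_bochner_integral_add W) auto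
    have P: "sqrt pi * exp (- x) * (Gamma s * bessel_clifford (s + 1/2 - 1) (y\<^sup>2)
          + y * (Gamma s * bessel_clifford (s + 3/2 - 1) (y\<^sup>2))) = Psi \<nu> x"
    proof -
      have e: "s + 1/2 - 1 = \<nu>" "s + 3/2 - 1 = \<nu> + 1" by (simp_all add: s_def)
      have "Psi \<nu> x = sqrt pi * (2 powr \<nu> * 2 powr (- \<nu>)) * Gamma s * exp (- x) * bessel_sum y \<nu>"
        by (simp add: Psi_def Phi_eq_bessel_sum[OF x] s_def y_def mult_ac)
      also have "2 powr \<nu> * 2 powr (- \<nu>) = 1" by (simp flip: powr_add)
      finally show ?thesis unfolding e bessel_sum_def by (simp add: algebra_simps)
    qed
    have E: "sqrt pi * exp (- x) * (W (1/2) u * (1 - u) powr (s - 1) + y * (W (3/2) u * (1 - u) powr (s - 1)))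
        = w u * exp (- \<nu> * \<theta> u)" if "u \<in> space ?M" for u
    proof -
      have "(1 - u) powr (s - 1) = (1 - u) powr (- 1/2) * (1 - u) powr \<nu>"
        by (simp add: s_def flip: powr_add)
      also have "(1 - u) powr \<nu> = exp (- \<nu> * \<theta> u)"
        using that by (simp add: powr_def \<theta>_def)
      finally show ?thesis by (simp add: w_def algebra_simps)
    qed
    show "has_bochner_integral ?M (\<lambda>u. w u * exp (- \<nu> * \<theta> u)) (Psi \<nu> x)"
      by (rule has_bochner_integral_cong[THEN iffD1, OF refl E refl I[unfolded P]])
  qed
qed

section \<open>Consequences for \<open>Psi\<close> and the upper Turan bound\<close>

lemma Psi_pos:
  assumes "\<nu> > -1/2" "x > 0"
  shows "Psi \<nu> x > 0"
proof -
  have "Phi \<nu> x > 0" using log_concave_Phi[OF assms(2)] assms(1) by (simp add: log_concave_on_def)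
  then show ?thesis using assms by (simp add: Psi_def)
qed

lemma
  assumes x: "x > 0"
  shows completely_monotonic_Psi: "completely_monotonic_on {-1/2<..} (\<lambda>\<nu>. Psi \<nu> x)"
    and log_convex_Psi: "log_convex_on {-1/2<..} (\<lambda>\<nu>. Psi \<nu> x)"
proof -
  obtain w \<theta> :: "real \<Rightarrow> real" where L: "\<theta> \<in> borel_measurable (lebesgue_on {0<..<1})"
    "\<And>u. u \<in> space (lebesgue_on {0<..<1}) \<Longrightarrow> \<theta> u \<ge> 0"
    "\<And>u. u \<in> space (lebesgue_on {0<..<1}) \<Longrightarrow> w u \<ge> 0"
    and I: "\<And>\<nu>. \<nu> > -1/2 \<Longrightarrow> has_bochner_integral (lebesgue_on {0<..<1}) (\<lambda>u. w u * exp (- \<nu> * \<theta> u)) (Psi \<nu> x)"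
    by (rule Psi_laplace[OF x], rule that)
  have int: "integrable (lebesgue_on {0<..<1}) (\<lambda>u. w u * exp (- \<nu> * \<theta> u))"
    and eq: "Psi \<nu> x = (\<integral>u. w u * exp (- \<nu> * \<theta> u) \<partial>lebesgue_on {0<..<1})" if "\<nu> > -1/2" for \<nu>
    using I[OF that] by (simp_all add: has_bochner_integral_iff)
  show "completely_monotonic_on {-1/2<..} (\<lambda>\<nu>. Psi \<nu> x)"
    by (rule completely_monotonic_laplace[OF L int eq])
  show "log_convex_on {-1/2<..} (\<lambda>\<nu>. Psi \<nu> x)"
    by (rule log_convex_laplace[OF L int eq Psi_pos[OF _ x]])
qed

text \<open>With a = \<nu> - 1/2, the \<open>Gamma\<close> factors turn log-convexity of
  \<open>Psi\<close> into a * Phi(\<nu>)^2 <= (a + 1) * Phi(\<nu> - 1) * Phi(\<nu> + 1), which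
  rearranges to the claim. The bound \<nu> > 1/2 places \<nu> - 1 in the domain of
  \<open>log_convex_Psi\<close>.\<close>

lemma Phi_turan_upper:
  assumes \<nu>: "\<nu> > 1/2" and x: "x > 0"
  shows "(Phi \<nu> x)\<^sup>2 - Phi (\<nu> - 1) x * Phi (\<nu> + 1) x \<le> (Phi \<nu> x)\<^sup>2 / (\<nu> + 1/2)"
proof -
  define a g where "a = \<nu> - 1/2" and "g = Gamma a"
  have a: "a > 0" and g: "g > 0" using \<nu> by (simp_all add: a_def g_def)
  have G1: "Gamma (a + 1) = a * g"
    unfolding g_def using a by (intro Gamma_plus1) (auto elim!: nonpos_Ints_cases)
  have G2: "Gamma (a + 2) = (a + 1) * (a * g)"
    using Gamma_plus1[of "a + 1"] a G1 by (force elim!: nonpos_Ints_cases simp: add.assoc)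
  have "(Psi ((\<nu> - 1 + (\<nu> + 1)) / 2) x)\<^sup>2 \<le> Psi (\<nu> - 1) x * Psi (\<nu> + 1) x"
    using \<nu> by (intro log_convex_on_midpoint[OF log_convex_Psi[OF x]]) auto
  then have le: "(Psi \<nu> x)\<^sup>2 \<le> Psi (\<nu> - 1) x * Psi (\<nu> + 1) x" by simp
  \<comment> \<open>The positive factor common to both sides once every \<open>Gamma\<close> value
    is expressed through \<open>g\<close>.\<close>
  define K where "K = (sqrt pi * 2 powr \<nu> * g)\<^sup>2 * a"
  have K: "K > 0" using a g by (simp add: K_def)
  have arg: "\<nu> + 1/2 = a + 1" "\<nu> - 1 + 1/2 = a" "\<nu> + 1 + 1/2 = a + 2" by (simp_all add: a_def)
  have "(2::real) powr (\<nu> - 1) * 2 powr (\<nu> + 1) = (2 powr \<nu>)\<^sup>2"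
    by (simp add: power2_eq_square flip: powr_add)
  moreover have "Psi (\<nu> - 1) x * Psi (\<nu> + 1) x
      = (sqrt pi)\<^sup>2 * (2 powr (\<nu> - 1) * 2 powr (\<nu> + 1)) * g\<^sup>2 * a * ((a + 1) * (Phi (\<nu> - 1) x * Phi (\<nu> + 1) x))"
    unfolding Psi_def arg G2 g_def[symmetric] by (simp only: power2_eq_square mult_ac)
  ultimately have "Psi (\<nu> - 1) x * Psi (\<nu> + 1) x = K * ((a + 1) * (Phi (\<nu> - 1) x * Phi (\<nu> + 1) x))"
    by (simp add: K_def power_mult_distrib)
  moreover have "(Psi \<nu> x)\<^sup>2 = K * (a * (Phi \<nu> x)\<^sup>2)"
    unfolding Psi_def arg G1 K_def by (simp only: power2_eq_square mult_ac)
  ultimately have "a * (Phi \<nu> x)\<^sup>2 \<le> (a + 1) * (Phi (\<nu> - 1) x * Phi (\<nu> + 1) x)"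
    using le K by simp
  then show ?thesis unfolding arg using a by (simp add: field_simps)
qed

theorem theorem2:
  shows "(\<forall>x>0. log_concave_on {-1<..} (\<lambda>nu. Phi nu x))
    \<and> (\<forall>x>0. completely_monotonic_on {-1/2<..} (\<lambda>nu. Psi nu x)
              \<and> log_convex_on {-1/2<..} (\<lambda>nu. Psi nu x))
    \<and> (\<forall>nu x. nu > 1/2 \<and> x > 0 \<longrightarrow>
          0 < (Phi nu x)\<^sup>2 - Phi (nu - 1) x * Phi (nu + 1) x
          \<and> (Phi nu x)\<^sup>2 - Phi (nu - 1) x * Phi (nu + 1) x \<le> (Phi nu x)\<^sup>2 / (nu + 1/2))
    \<and> (\<forall>nu x. nu > -1 \<and> x > 0 \<longrightarrow> 0 < (Phi nu x)\<^sup>2 - Phi (nu - 1) x * Phi (nu + 1) x)"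
proof -
  have pos: "0 < (Phi nu x)\<^sup>2 - Phi (nu - 1) x * Phi (nu + 1) x" if "nu > -1" "x > 0" for nu x
    using Phi_turan_pos[OF that] by simp
  have "0 < (Phi nu x)\<^sup>2 - Phi (nu - 1) x * Phi (nu + 1) x" if "nu > 1/2" "x > 0" for nu x
    by (rule pos) (use that in auto)
  then show ?thesis
    using log_concave_Phi completely_monotonic_Psi log_convex_Psi Phi_turan_upper pos by blast
qed

end
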